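(* Let $q\in\mathbb{C}^{\ast}\setminus\{1,-1\}$ be a root of unity and let $m$ be the smallest positive integer such that $q^m=1$. Let $\mathcal{U}_q=\mathcal{U}(SU(2))_q$ be the unital associative $\mathbb{C}$-algebra defined in the context. Then: (i) if $m$ is odd, $\mathcal{U}_q$ has $N$-dimensional irreducible representations if $1\le N\le m$; (ii) if $m$ is even, $\mathcal{U}_q$ has $N$-dimensional irreducible representations if $1\le N\le \frac m2$ or $N=m$; (iii) in both cases, the irreducible representations of dimension $m$ are not always highest weight representations.
   Context: $\mathcal{U}(SU(2))_q$ is the unital associative algebra over $\mathbb{C}$ generated by $q^{H/2}, q^{-H/2}, J^+, J^-$ (here $q^{\pm H/2}$ are just names of generators) with relations $$q^{H/2}q^{-H/2}=q^{-H/2}q^{H/2}=1,\qquad q^{H/2}J^{\pm}q^{-H/2}=q^{\pm 1}J^{\pm},\qquad [J^+,J^-]=\frac{q^{H}-q^{-H}}{q-q^{-1}},$$ where $q^{H}=(q^{H/2})^2$ and $q^{-H}=(q^{-H/2})^2$. Only the algebra structure is used. Representations are over $\mathbb{C}$; an irreducible representation is the same as a simple module. A highest weight representation is one generated by a nonzero vector $v$ that is an eigenvector of $q^{H/2}$ and satisfies $J^+v=0$. *)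

theory Defs
  imports
    "HOL-Library.Poly_Mapping"
    "HOL-Algebra.QuotRing"
    "Jordan_Normal_Form.VS_Connect"
begin

(* Words are wrapped in a datatype so that the additively written monoid structure required by
   the convolution product of Poly_Mapping (0 = empty word, + = concatenation) is not imposed
   on lists globally. *)

datatype 'g free_word = FreeWord "'g list"

instantiation free_word :: (type) monoid_add
begin

definition zero_free_word :: "'a free_word" where
  "0 = FreeWord []"

fun plus_free_word :: "'a free_word \<Rightarrow> 'a free_word \<Rightarrow> 'a free_word" where
  "FreeWord u + FreeWord v = FreeWord (u @ v)"

instance
proof
  fix a b c :: "'a free_word"
  show "a + b + c = a + (b + c)"
    by (cases a; cases b; cases c) simp
  show "0 + a = a" "a + 0 = a"
    by (cases a; simp add: zero_free_word_def)+
qed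

end

(* The generators q^{H/2}, q^{-H/2}, J^+, J^-. *)

datatype uq_gen = QH | QHinv | Jplus | Jminus

(* The free unital associative complex algebra on the four generators. *)

type_synonym uq_free = "uq_gen free_word \<Rightarrow>\<^sub>0 complex"

definition fgen :: "uq_gen \<Rightarrow> uq_free" where
  "fgen g = Poly_Mapping.single (FreeWord [g]) 1"

definition fscalar :: "complex \<Rightarrow> uq_free" where
  "fscalar c = Poly_Mapping.single 0 c"

definition uq_relators :: "complex \<Rightarrow> uq_free set" where
  "uq_relators q =
    {fgen QH * fgen QHinv - 1,
     fgen QHinv * fgen QH - 1,
     fgen QH * fgen Jplus * fgen QHinv - fscalar q * fgen Jplus,
     fgen QH * fgen Jminus * fgen QHinv - fscalar (inverse q) * fgen Jminus,
     (fgen Jplus * fgen Jminus - fgen Jminus * fgen Jplus)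
       - fscalar (inverse (q - inverse q)) * ((fgen QH)^2 - (fgen QHinv)^2)}"

(* genideal yields two-sided ideals: the locale ideal demands absorption on both sides. *)

definition uq_ideal :: "complex \<Rightarrow> uq_free set" where
  "uq_ideal q = genideal class_ring (uq_relators q)"

definition Uq :: "complex \<Rightarrow> uq_free set ring" where
  "Uq q = class_ring Quot uq_ideal q"

definition uq_class :: "complex \<Rightarrow> uq_free \<Rightarrow> uq_free set" where
  "uq_class q a = uq_ideal q +>\<^bsub>class_ring\<^esub> a"

definition uq_gen_elt :: "complex \<Rightarrow> uq_gen \<Rightarrow> uq_free set" where
  "uq_gen_elt q g = uq_class q (fgen g)"

lemma ideal_uq_ideal: "ideal (uq_ideal q) class_ring"
  unfolding uq_ideal_def by (rule ring.genideal_ideal[OF class_ring.ring_axioms]) simp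

lemma ring_Uq: "ring (Uq q)"
  unfolding Uq_def by (rule ideal.quotient_is_ring[OF ideal_uq_ideal])

(* A representation on the complex vector space V. The last conjunct makes it a homomorphism of
   complex algebras, not just of rings: the scalars of the algebra act as the scalars of V. *)

definition uq_rep ::
  "complex \<Rightarrow> (complex, 'v) module \<Rightarrow> (uq_free set \<Rightarrow> 'v \<Rightarrow> 'v) \<Rightarrow> bool" where
  "uq_rep q V \<rho> \<longleftrightarrow>
     vectorspace class_ring V \<and>
     (\<forall>a\<in>carrier (Uq q). \<rho> a \<in> LinearCombinations.module_hom class_ring V V) \<and>
     (\<forall>a\<in>carrier (Uq q). \<forall>b\<in>carrier (Uq q). \<forall>v\<in>carrier V.
        \<rho> (a \<oplus>\<^bsub>Uq q\<^esub> b) v = \<rho> a v \<oplus>\<^bsub>V\<^esub> \<rho> b v \<and>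
        \<rho> (a \<otimes>\<^bsub>Uq q\<^esub> b) v = \<rho> a (\<rho> b v)) \<and>
     (\<forall>v\<in>carrier V. \<rho> \<one>\<^bsub>Uq q\<^esub> v = v) \<and>
     (\<forall>c. \<forall>v\<in>carrier V. \<rho> (uq_class q (fscalar c)) v = c \<odot>\<^bsub>V\<^esub> v)"

definition uq_subrep ::
  "complex \<Rightarrow> (complex, 'v) module \<Rightarrow> (uq_free set \<Rightarrow> 'v \<Rightarrow> 'v) \<Rightarrow> 'v set \<Rightarrow> bool" where
  "uq_subrep q V \<rho> W \<longleftrightarrow>
     VectorSpace.subspace class_ring W V \<and> (\<forall>a\<in>carrier (Uq q). \<forall>w\<in>W. \<rho> a w \<in> W)"

definition uq_irreducible ::
  "complex \<Rightarrow> (complex, 'v) module \<Rightarrow> (uq_free set \<Rightarrow> 'v \<Rightarrow> 'v) \<Rightarrow> bool" where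
  "uq_irreducible q V \<rho> \<longleftrightarrow>
     uq_rep q V \<rho> \<and> carrier V \<noteq> {\<zero>\<^bsub>V\<^esub>} \<and>
     (\<forall>W. uq_subrep q V \<rho> W \<longrightarrow> W = {\<zero>\<^bsub>V\<^esub>} \<or> W = carrier V)"

definition uq_highest_weight ::
  "complex \<Rightarrow> (complex, 'v) module \<Rightarrow> (uq_free set \<Rightarrow> 'v \<Rightarrow> 'v) \<Rightarrow> bool" where
  "uq_highest_weight q V \<rho> \<longleftrightarrow>
     uq_rep q V \<rho> \<and>
     (\<exists>v\<in>carrier V. v \<noteq> \<zero>\<^bsub>V\<^esub> \<and>
        (\<exists>l. \<rho> (uq_gen_elt q QH) v = l \<odot>\<^bsub>V\<^esub> v) \<and>
        \<rho> (uq_gen_elt q Jplus) v = \<zero>\<^bsub>V\<^esub> \<and>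
        {\<rho> a v | a. a \<in> carrier (Uq q)} = carrier V)"

(* vectorspace.dim is meaningless on infinite-dimensional spaces, hence fin_dim. *)

definition has_dim :: "(complex, 'v) module \<Rightarrow> nat \<Rightarrow> bool" where
  "has_dim V N \<longleftrightarrow> vectorspace.fin_dim class_ring V \<and> vectorspace.dim class_ring V = N"

end

(* Let K = q^{H/2} act on a basis v_0, ..., v_{n-1} with eigenvalues l q^{-k}, where l^2 = q^{n-1},
   let J^- shift v_k to v_{k+1}, and let J^+ send v_k to a multiple g k of v_{k-1}. The commutator
   relation forces g k = d + [k][n-k]. The ladder can be closed in two ways: cut off at both ends
   (d = 0), which gives the usual highest weight modules, or, if q^n = 1, made cyclic by
   J^- v_{n-1} = v_0 and J^+ v_0 = d v_{n-1}. If q^k is not 1 for 0 < k < n, then K has simple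
   spectrum, so every invariant subspace contains some v_k; if moreover g k is nonzero for
   0 < k < n, it contains all of them. In the cyclic case with n = m a generic d makes every g k
   nonzero, so J^+ is injective and there is no highest weight vector. *)

theory Submission
  imports Defs
begin

section \<open>Linear extension from words to the free algebra\<close>

text \<open>Inserting a fresh key is the same as adding a monomial. This reduces identities that are
  additive in an algebra element to single words.\<close>

lemma poly_mapping_add_induct [case_names zero single add]:
  fixes a :: "'a \<Rightarrow>\<^sub>0 'b::comm_monoid_add"
  assumes zero: "P 0"
    and single: "\<And>w c. P (Poly_Mapping.single w c)"
    and add: "\<And>a b. P a \<Longrightarrow> P b \<Longrightarrow> P (a + b)"
  shows "P a"
proof (induction a rule: Poly_Mapping.update_induct)
  case const
  show ?case by (rule zero)
next
  case (update f w c)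
  have "Poly_Mapping.update w c f = Poly_Mapping.single w c + f"
    using update.hyps
    by (intro poly_mapping_eqI)
       (auto simp: Poly_Mapping.lookup_update lookup_add lookup_single when_def in_keys_iff)
  then show ?case
    using add[OF single update.IH] by simp
qed

definition lin_ext :: "('w \<Rightarrow> 'b) \<Rightarrow> ('w \<Rightarrow>\<^sub>0 'b) \<Rightarrow> 'b::comm_semiring_0" where
  "lin_ext \<phi> a = (\<Sum>w\<in>Poly_Mapping.keys a. Poly_Mapping.lookup a w * \<phi> w)"

text \<open>Keys may cancel in a sum, so additivity needs all three sums over one common finite set;
  the extra terms vanish.\<close>

lemma lin_ext_superset:
  assumes "finite S" "Poly_Mapping.keys a \<subseteq> S"
  shows "lin_ext \<phi> a = (\<Sum>w\<in>S. Poly_Mapping.lookup a w * \<phi> w)"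
  unfolding lin_ext_def using assms
  by (intro sum.mono_neutral_left) (auto simp: in_keys_iff)

lemma lin_ext_zero [simp]: "lin_ext \<phi> 0 = 0"
  by (simp add: lin_ext_def)

lemma lin_ext_single [simp]: "lin_ext \<phi> (Poly_Mapping.single w c) = c * \<phi> w"
  by (simp add: lin_ext_superset[where S = "{w}"])

lemma lin_ext_add: "lin_ext \<phi> (a + b) = lin_ext \<phi> a + lin_ext \<phi> b"
proof -
  let ?S = "Poly_Mapping.keys a \<union> Poly_Mapping.keys b"
  have "lin_ext \<phi> (a + b) = (\<Sum>w\<in>?S. Poly_Mapping.lookup (a + b) w * \<phi> w)"
    using Poly_Mapping.keys_add[of a b] by (intro lin_ext_superset) auto
  also have "\<dots> = (\<Sum>w\<in>?S. Poly_Mapping.lookup a w * \<phi> w)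
      + (\<Sum>w\<in>?S. Poly_Mapping.lookup b w * \<phi> w)"
    by (simp add: lookup_add algebra_simps sum.distrib)
  also have "\<dots> = lin_ext \<phi> a + lin_ext \<phi> b"
    by (simp add: lin_ext_superset[where S = ?S])
  finally show ?thesis .
qed

section \<open>Operators on C^n and the free algebra\<close>

locale linear_action =
  fixes n :: nat and act :: "'g \<Rightarrow> complex vec \<Rightarrow> complex vec"
  assumes act_closed [simp]: "v \<in> carrier_vec n \<Longrightarrow> act g v \<in> carrier_vec n"
    and act_add: "v \<in> carrier_vec n \<Longrightarrow> w \<in> carrier_vec n \<Longrightarrow> act g (v + w) = act g v + act g w"
    and act_smult: "v \<in> carrier_vec n \<Longrightarrow> act g (c \<cdot>\<^sub>v v) = c \<cdot>\<^sub>v act g v"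
begin

text \<open>\<open>foldr\<close> lets the last letter act first, so concatenation of words becomes
  composition of operators.\<close>

fun word_act :: "'g free_word \<Rightarrow> complex vec \<Rightarrow> complex vec" where
  "word_act (FreeWord gs) v = foldr act gs v"

lemma word_act_zero [simp]: "word_act 0 v = v"
  by (simp add: zero_free_word_def)

lemma word_act_add: "word_act (u + w) v = word_act u (word_act w v)"
  by (cases u; cases w) simp

lemma foldr_act_linear:
  assumes "v \<in> carrier_vec n"
  shows "foldr act gs v \<in> carrier_vec n"
    and "w \<in> carrier_vec n \<Longrightarrow> foldr act gs (v + w) = foldr act gs v + foldr act gs w"
    and "foldr act gs (c \<cdot>\<^sub>v v) = c \<cdot>\<^sub>v foldr act gs v"
proof -
  have closed: "foldr act gs x \<in> carrier_vec n" if "x \<in> carrier_vec n" for gs x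
    using that by (induction gs) auto
  show "foldr act gs v \<in> carrier_vec n"
    using assms by (rule closed)
  show "foldr act gs (v + w) = foldr act gs v + foldr act gs w" if "w \<in> carrier_vec n"
    using assms that by (induction gs) (auto simp: act_add closed)
  show "foldr act gs (c \<cdot>\<^sub>v v) = c \<cdot>\<^sub>v foldr act gs v"
    using assms by (induction gs) (auto simp: act_smult closed)
qed

lemma word_act_closed [simp]: "v \<in> carrier_vec n \<Longrightarrow> word_act u v \<in> carrier_vec n"
  by (cases u) (simp add: foldr_act_linear)

lemma dim_word_act [simp]: "v \<in> carrier_vec n \<Longrightarrow> dim_vec (word_act u v) = n"
  by (rule carrier_vecD[OF word_act_closed])

lemma word_act_add_vec:
  "v \<in> carrier_vec n \<Longrightarrow> w \<in> carrier_vec n \<Longrightarrow> word_act u (v + w) = word_act u v + word_act u w"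
  by (cases u) (simp add: foldr_act_linear)

lemma word_act_smult: "v \<in> carrier_vec n \<Longrightarrow> word_act u (c \<cdot>\<^sub>v v) = c \<cdot>\<^sub>v word_act u v"
  by (cases u) (simp add: foldr_act_linear)

text \<open>Defined coordinatewise: vectors of all dimensions share one type, which has no single
  zero vector, whereas coordinates are complex numbers.\<close>

definition alg_act :: "('g free_word \<Rightarrow>\<^sub>0 complex) \<Rightarrow> complex vec \<Rightarrow> complex vec" where
  "alg_act a v = vec n (\<lambda>i. lin_ext (\<lambda>u. word_act u v $ i) a)"

lemma alg_act_closed [simp]: "alg_act a v \<in> carrier_vec n"
  by (simp add: alg_act_def)

lemma dim_alg_act [simp]: "dim_vec (alg_act a v) = n"
  by (simp add: alg_act_def)

lemma alg_act_zero [simp]: "alg_act 0 v = 0\<^sub>v n"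
  by (auto simp: alg_act_def)

lemma alg_act_add: "alg_act (a + b) v = alg_act a v + alg_act b v"
  by (auto simp: alg_act_def lin_ext_add)

lemma alg_act_single:
  "v \<in> carrier_vec n \<Longrightarrow> alg_act (Poly_Mapping.single u c) v = c \<cdot>\<^sub>v word_act u v"
  by (rule eq_vecI) (simp_all add: alg_act_def)

lemma alg_act_one [simp]: "v \<in> carrier_vec n \<Longrightarrow> alg_act 1 v = v"
  using alg_act_single[of v 0 1] by simp

lemma alg_act_diff: "alg_act (a - b) v = alg_act a v - alg_act b v"
proof -
  have "alg_act a v = alg_act (a - b) v + alg_act b v"
    by (simp flip: alg_act_add)
  then have "alg_act a v $ i = alg_act (a - b) v $ i + alg_act b v $ i" if "i < n" for i
    using that by (metis dim_alg_act index_add_vec(1))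
  then show ?thesis
    by (intro eq_vecI) simp_all
qed

lemma alg_act_add_vec:
  assumes "v \<in> carrier_vec n" "w \<in> carrier_vec n"
  shows "alg_act a (v + w) = alg_act a v + alg_act a w"
proof (induction a rule: poly_mapping_add_induct)
  case (add a b)
  then show ?case
    by (intro eq_vecI) (simp_all add: alg_act_add)
qed (use assms in \<open>auto simp: alg_act_single word_act_add_vec smult_add_distrib_vec[of _ n]\<close>)

lemma alg_act_smult:
  assumes "v \<in> carrier_vec n"
  shows "alg_act a (c \<cdot>\<^sub>v v) = c \<cdot>\<^sub>v alg_act a v"
proof (induction a rule: poly_mapping_add_induct)
  case (add a b)
  then show ?case
    by (simp add: alg_act_add smult_add_distrib_vec[of _ n])
qed (use assms in \<open>auto simp: alg_act_single word_act_smult smult_smult_assoc mult.commute\<close>)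

lemma alg_act_zero_vec [simp]: "alg_act a (0\<^sub>v n) = 0\<^sub>v n"
proof -
  have "0 \<cdot>\<^sub>v v = 0\<^sub>v n" if "v \<in> carrier_vec n" for v :: "complex vec"
    using that by auto
  then show ?thesis
    using alg_act_smult[of "0\<^sub>v n" a 0] by simp
qed

text \<open>Both sides are additive in \<open>a\<close> and in \<open>b\<close>, so two inductions
  leave only monomials, where \<open>word_act_add\<close> and linearity of words apply.\<close>

lemma alg_act_mult:
  assumes v: "v \<in> carrier_vec n"
  shows "alg_act (a * b) v = alg_act a (alg_act b v)"
proof (induction a rule: poly_mapping_add_induct)
  case (single u c)
  show ?case
  proof (induction b rule: poly_mapping_add_induct)
    case zero
    show ?case
      by simp
  next
    case (single w d)
    show ?case
      using v by (simp add: mult_single alg_act_single word_act_add word_act_smult smult_smult_assoc)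
  next
    case (add a b)
    then show ?case
      by (simp add: distrib_left alg_act_add alg_act_add_vec)
  qed
next
  case (add a b)
  then show ?case
    by (simp add: distrib_right alg_act_add)
qed simp

end

section \<open>Passage to the quotient algebra\<close>

locale uq_action = linear_action n act for n and act :: "uq_gen \<Rightarrow> complex vec \<Rightarrow> complex vec" +
  fixes q :: complex
  assumes QH_QHinv: "v \<in> carrier_vec n \<Longrightarrow> act QH (act QHinv v) = v"
    and QHinv_QH: "v \<in> carrier_vec n \<Longrightarrow> act QHinv (act QH v) = v"
    and QH_Jplus: "v \<in> carrier_vec n \<Longrightarrow> act QH (act Jplus (act QHinv v)) = q \<cdot>\<^sub>v act Jplus v"
    and QH_Jminus:
      "v \<in> carrier_vec n \<Longrightarrow> act QH (act Jminus (act QHinv v)) = inverse q \<cdot>\<^sub>v act Jminus v"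
    and Jplus_Jminus:
      "v \<in> carrier_vec n \<Longrightarrow> act Jplus (act Jminus v) - act Jminus (act Jplus v)
        = inverse (q - inverse q) \<cdot>\<^sub>v (act QH (act QH v) - act QHinv (act QHinv v))"
begin

lemma alg_act_fgen: "v \<in> carrier_vec n \<Longrightarrow> alg_act (fgen g) v = act g v"
  by (simp add: fgen_def alg_act_single)

lemma alg_act_fscalar: "v \<in> carrier_vec n \<Longrightarrow> alg_act (fscalar c) v = c \<cdot>\<^sub>v v"
  by (simp add: fscalar_def alg_act_single)

lemma alg_act_relator:
  assumes v: "v \<in> carrier_vec n" and "r \<in> uq_relators q"
  shows "alg_act r v = 0\<^sub>v n"
proof -
  have self: "w - w = 0\<^sub>v n" if "w \<in> carrier_vec n" for w :: "complex vec"
    using that by auto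
  show ?thesis
    using assms(2) v unfolding uq_relators_def
    by (auto simp: alg_act_diff alg_act_mult alg_act_fgen alg_act_fscalar power2_eq_square
        QH_QHinv QHinv_QH QH_Jplus QH_Jminus Jplus_Jminus self)
qed

definition annihilator :: "uq_free set" where
  "annihilator = {a. \<forall>v\<in>carrier_vec n. alg_act a v = 0\<^sub>v n}"

text \<open>Absorption holds on both sides: a left factor is applied to the zero vector, and a right
  factor only replaces \<open>v\<close> by another vector of C^n.\<close>

lemma ideal_annihilator: "ideal annihilator class_ring"
proof (rule idealI)
  show "ring (class_ring :: uq_free ring)"
    by (rule class_ring.ring_axioms)
  have G: "group (add_monoid (class_ring :: uq_free ring))"
    by (rule abelian_group.a_group[OF ring.is_abelian_group[OF class_ring.ring_axioms]])
  have uminus: "- a \<in> annihilator" if "a \<in> annihilator" for a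
    using that alg_act_diff[of 0 a] by (auto simp: annihilator_def)
  show "subgroup annihilator (add_monoid class_ring)"
  proof (rule group.subgroupI[OF G])
    show "annihilator \<noteq> {}"
      using alg_act_zero unfolding annihilator_def by blast
    show "annihilator \<subseteq> carrier (add_monoid class_ring)"
      by simp
    fix a b :: uq_free assume a: "a \<in> annihilator"
    have "inv\<^bsub>add_monoid class_ring\<^esub> a = - a"
      by (rule group.inv_equality[OF G]) simp_all
    then show "inv\<^bsub>add_monoid class_ring\<^esub> a \<in> annihilator"
      using uminus[OF a] by simp
    assume "b \<in> annihilator"
    then show "a \<otimes>\<^bsub>add_monoid class_ring\<^esub> b \<in> annihilator"
      using a by (simp add: annihilator_def alg_act_add)
  qed
qed (auto simp: annihilator_def alg_act_mult)

lemma uq_ideal_subset_annihilator: "uq_ideal q \<subseteq> annihilator"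
  unfolding uq_ideal_def
  by (rule ring.genideal_minimal[OF class_ring.ring_axioms ideal_annihilator])
     (auto simp: annihilator_def alg_act_relator)

text \<open>A coset acts through an arbitrarily chosen representative; \<open>uq_act_class\<close>
  shows that the choice does not matter.\<close>

definition uq_act :: "uq_free set \<Rightarrow> complex vec \<Rightarrow> complex vec" where
  "uq_act x v = alg_act (SOME a. a \<in> x) v"

text \<open>The chosen representative differs from \<open>a\<close> by an element of the ideal,
  which annihilates every vector.\<close>

lemma uq_act_class:
  assumes v: "v \<in> carrier_vec n"
  shows "uq_act (uq_class q a) v = alg_act a v"
proof -
  interpret ideal "uq_ideal q" class_ring by (rule ideal_uq_ideal)
  define b where "b = (SOME b. b \<in> uq_class q a)"
  have "a \<in> uq_class q a"
    unfolding uq_class_def by (rule a_rcos_self) simp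
  then have "b \<in> uq_class q a"
    unfolding b_def by (rule someI)
  then obtain r where r: "r \<in> uq_ideal q" "b = r + a"
    by (auto simp: uq_class_def a_r_coset_def')
  then have "alg_act r v = 0\<^sub>v n"
    using uq_ideal_subset_annihilator v by (auto simp: annihilator_def)
  then show ?thesis
    using r by (simp add: uq_act_def flip: b_def) (simp add: alg_act_add)
qed

end

lemma carrier_Uq: "carrier (Uq q) = range (uq_class q)"
  by (auto simp: Uq_def FactRing_def A_RCOSETS_def' uq_class_def)

lemma uq_class_hom:
  "uq_class q a \<oplus>\<^bsub>Uq q\<^esub> uq_class q b = uq_class q (a + b)"
  "uq_class q a \<otimes>\<^bsub>Uq q\<^esub> uq_class q b = uq_class q (a * b)"
  "\<one>\<^bsub>Uq q\<^esub> = uq_class q 1"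
proof -
  interpret ideal "uq_ideal q" class_ring by (rule ideal_uq_ideal)
  note hom = rcos_ring_hom
  show "uq_class q a \<oplus>\<^bsub>Uq q\<^esub> uq_class q b = uq_class q (a + b)"
    using ring_hom_add[OF hom, of a b] by (simp add: Uq_def uq_class_def)
  show "uq_class q a \<otimes>\<^bsub>Uq q\<^esub> uq_class q b = uq_class q (a * b)"
    using ring_hom_mult[OF hom, of a b] by (simp add: Uq_def uq_class_def)
  show "\<one>\<^bsub>Uq q\<^esub> = uq_class q 1"
    using ring_hom_one[OF hom] by (simp add: Uq_def uq_class_def)
qed

context uq_action
begin

abbreviation V :: "(complex, complex vec) module" where
  "V \<equiv> module_vec TYPE(complex) n"

text \<open>Every element of the quotient is a class, and the projection respects the operations, so
  each condition becomes a fact about \<open>alg_act\<close>.\<close>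

lemma uq_rep_uq_act: "uq_rep q V uq_act"
  unfolding uq_rep_def
  by (auto simp: vec_vs carrier_Uq uq_class_hom uq_act_class module_vec_simps
      LinearCombinations.module_hom_def alg_act_add alg_act_mult alg_act_add_vec alg_act_smult
      alg_act_fscalar)

lemma uq_act_gen: "v \<in> carrier_vec n \<Longrightarrow> uq_act (uq_gen_elt q g) v = act g v"
  by (simp add: uq_gen_elt_def uq_act_class alg_act_fgen)

lemma has_dim_V: "has_dim V n"
  unfolding has_dim_def by (intro conjI vec_space.fin_dim vec_space.dim_is_n)

end

section \<open>q-integers\<close>

text \<open>The q-integer [k], which can vanish for positive \<open>k\<close> when \<open>q\<close>
  is a root of unity.\<close>

definition qint :: "complex \<Rightarrow> nat \<Rightarrow> complex" where
  "qint q k = (q ^ k - inverse q ^ k) / (q - inverse q)"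

lemma qint_0 [simp]: "qint q 0 = 0"
  by (simp add: qint_def)

text \<open>This is [k+1][r] - [k][r+1] = [r-k], with [r-k] written out in natural powers because
  \<open>r - k\<close> may be negative. For n = k + r + 1 the left side is the increment of
  [k][n-k].\<close>

lemma qint_step:
  assumes "q - inverse q \<noteq> 0"
  shows "qint q (Suc k) * qint q r - qint q k * qint q (Suc r)
    = inverse (q - inverse q) * (q ^ r * inverse q ^ k - inverse q ^ r * q ^ k)"
proof -
  have combine: "x / D * (y / D) - z / D * (w / D) = inverse D * u"
    if "D \<noteq> 0" "x * y - z * w = D * u" for x y z w u D :: complex
    using that by (simp add: divide_simps)
  \<comment> \<open>Polynomial core, to be read with \<open>a\<close>, \<open>b\<close> as the
    powers of \<open>q\<close> with exponents \<open>k\<close>, \<open>r\<close>, and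
    \<open>p\<close>, \<open>A\<close>, \<open>B\<close> as the inverses of \<open>q\<close>,
    \<open>a\<close>, \<open>b\<close>.\<close>
  have "(q * a - p * A) * (b - B) - (a - A) * (q * b - p * B) = (q - p) * (b * A - B * a)"
    for a A b B p :: complex
    by (simp add: algebra_simps)
  then show ?thesis
    unfolding qint_def power_Suc using assms by (intro combine)
qed

text \<open>[k] = 0 means that \<open>q ^ k\<close> equals its own inverse.\<close>

lemma qint_nonzero:
  assumes "q \<noteq> 0" "q - inverse q \<noteq> 0" "q ^ (2 * k) \<noteq> 1"
  shows "qint q k \<noteq> 0"
proof
  assume "qint q k = 0"
  then have "q ^ k = inverse q ^ k"
    using assms(2) unfolding qint_def divide_eq_0_iff right_minus_eq by blast
  then have "q ^ k * q ^ k = inverse q ^ k * q ^ k"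
    by (rule arg_cong)
  also have "\<dots> = 1"
    unfolding power_mult_distrib[symmetric] using assms(1) by simp
  finally have "q ^ (2 * k) = 1"
    unfolding mult_2 power_add .
  with assms(3) show False by contradiction
qed

text \<open>With \<open>x = q ^ k\<close>, \<open>y = q ^ r\<close> and \<open>X\<close>,
  \<open>Y\<close>, \<open>m\<close> the inverses of \<open>x\<close>, \<open>y\<close>,
  \<open>l\<close>, this evaluates the squared eigenvalues of K and its inverse on v_k as the powers
  of \<open>q\<close> with exponents r - k and k - r.\<close>

lemma squares_identity:
  fixes l m x X y Y :: complex
  assumes "l\<^sup>2 = x * y" "l * m = 1" "x * X = 1" "y * Y = 1"
  shows "(l * X)\<^sup>2 = y * X" "(m * x)\<^sup>2 = Y * x"
  using assms by Groebner_Basis.algebra+ \<comment> \<open>qualified because HOL-Algebra redefines the method name\<close>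

section \<open>Ladder modules and the defining relations\<close>

text \<open>\<open>c\<close> is the coefficient with which J^- carries v_{n-1} to v_0, and
  \<open>d\<close> the one with which J^+ carries v_0 to v_{n-1}. In the cyclic case
  \<open>q ^ n = 1\<close> makes the eigenvalues of K match after one turn.\<close>

locale ladder =
  fixes q l c d :: complex and n :: nat
  assumes n_pos: "0 < n"
    and q_nonzero: "q \<noteq> 0"
    and q_diff_nonzero: "q - inverse q \<noteq> 0"
    and l_square: "l\<^sup>2 = q ^ (n - 1)"
    and closing: "c = 0 \<and> d = 0 \<or> c = 1 \<and> q ^ n = 1"
begin

definition coeff :: "nat \<Rightarrow> complex" where
  "coeff k = d + qint q k * qint q (n - k)"

text \<open>Neighbours on the cycle of indices below \<open>n\<close>. In the truncated case the
  wrap is multiplied by \<open>c = 0\<close> or by \<open>coeff n = 0\<close>.\<close>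

definition up :: "nat \<Rightarrow> nat" where
  "up i = (if Suc i = n then 0 else Suc i)"

definition down :: "nat \<Rightarrow> nat" where
  "down i = (if i = 0 then n - 1 else i - 1)"

definition step :: "nat \<Rightarrow> complex" where
  "step i = (if i = 0 then c else 1)"

text \<open>Written on coordinates, so the shifts look reversed: coordinate \<open>i\<close> of J^-
  v is read off at \<open>down i\<close>, because J^- moves v_k to v_{k+1}.\<close>

fun ladder_act :: "uq_gen \<Rightarrow> complex vec \<Rightarrow> complex vec" where
  "ladder_act QH v = vec n (\<lambda>i. l * inverse q ^ i * v $ i)"
| "ladder_act QHinv v = vec n (\<lambda>i. inverse l * q ^ i * v $ i)"
| "ladder_act Jplus v = vec n (\<lambda>i. coeff (Suc i) * v $ up i)"
| "ladder_act Jminus v = vec n (\<lambda>i. step i * v $ down i)"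

lemma up_less [simp]: "i < n \<Longrightarrow> up i < n"
  by (simp add: up_def)

lemma down_less [simp]: "i < n \<Longrightarrow> down i < n"
  by (auto simp: down_def)

lemma down_up: "i < n \<Longrightarrow> down (up i) = i"
  by (auto simp: up_def down_def)

lemma up_down: "i < n \<Longrightarrow> up (down i) = i"
  by (auto simp: up_def down_def)

lemma l_nonzero: "l \<noteq> 0"
  using l_square q_nonzero by auto

lemma q_power_inverse: "q ^ k * inverse q ^ k = 1"
  using q_nonzero by (simp flip: power_mult_distrib)

lemma coeff_ends: "coeff 0 = d" "coeff n = d" "c * d = d"
  using closing by (auto simp: coeff_def)

text \<open>The eigenvalue of [J^+, J^-] on v_k. Since \<open>l\<close> squared is q^(k+r) for r = n
  - 1 - k, the right side becomes that of \<open>qint_step\<close>.\<close>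

lemma coeff_step:
  assumes "k < n"
  shows "coeff (Suc k) - coeff k
    = inverse (q - inverse q) * ((l * inverse q ^ k)\<^sup>2 - (inverse l * q ^ k)\<^sup>2)"
proof -
  define r where "r = n - Suc k"
  have r: "n - k = Suc r" "n - 1 = k + r"
    using assms by (auto simp: r_def)
  have "l\<^sup>2 = q ^ k * q ^ r" "l * inverse l = 1"
    using l_square r l_nonzero by (simp_all add: power_add)
  note squares = squares_identity[OF this q_power_inverse q_power_inverse]
  show ?thesis
    unfolding squares using qint_step[OF q_diff_nonzero, of k r]
    by (simp add: coeff_def r flip: r_def)
qed

text \<open>\<open>step (up i)\<close> differs from 1 at most at the wrap, where the other factor is
  \<open>coeff n = d\<close> and \<open>c * d = d\<close>.\<close>

lemma coeff_step_up: "coeff (Suc i) * step (up i) = coeff (Suc i)"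
  using coeff_ends by (auto simp: up_def step_def mult.commute)

lemma step_coeff_down: "i < n \<Longrightarrow> step i * coeff (Suc (down i)) = coeff i"
  using coeff_ends n_pos by (auto simp: down_def step_def)

text \<open>The conjugation relation for J^+ at coordinate \<open>i\<close>. At the wrap either the
  coefficient vanishes or \<open>q ^ n = 1\<close> lets the exponent 0 stand for
  \<open>n\<close>.\<close>

lemma q_power_up: "q ^ up i * inverse q ^ i * coeff (Suc i) = q * coeff (Suc i)"
proof -
  have eq: "q ^ Suc i * inverse q ^ i = q"
    by (simp only: power_Suc mult.assoc q_power_inverse mult_1_right)
  consider "Suc i \<noteq> n" | "coeff (Suc i) = 0" | "Suc i = n" "q ^ Suc i = 1"
    using closing coeff_ends(2) by metis
  then show ?thesis
  proof cases
    case 1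
    then show ?thesis
      unfolding up_def by (simp only: if_False eq)
  next
    case 2
    then show ?thesis
      by (simp only: mult_zero_right)
  next
    case 3
    have "q ^ up i = q ^ Suc i"
      unfolding 3(2) unfolding up_def using 3(1) by simp
    then show ?thesis
      by (simp only: eq)
  qed
qed

text \<open>The counterpart for J^-. At the wrap \<open>down 0 = n - 1\<close>, and either
  \<open>c = 0\<close> or \<open>q ^ (n - 1)\<close> is the inverse of \<open>q\<close>.\<close>

lemma q_power_down: "q ^ down i * inverse q ^ i * step i = inverse q * step i"
proof (cases i)
  case 0
  have "c = 0 \<or> q * q ^ (n - 1) = 1"
    using closing n_pos by (cases n) auto
  then have "c = 0 \<or> q ^ (n - 1) = inverse q"
    using inverse_unique by metis
  then show ?thesis
    using 0 by (auto simp: down_def step_def)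
next
  case (Suc j)
  have "q ^ j * inverse q ^ Suc j = inverse q"
    by (simp only: power_Suc mult.left_commute q_power_inverse mult_1_right)
  then show ?thesis
    unfolding Suc down_def step_def by (simp only: diff_Suc_1 nat.distinct if_False mult_1_right)
qed

lemma conjugate_QH: "l * A * (b * (inverse l * B * x)) = B * A * b * x"
  using l_nonzero by (simp add: field_simps)

sublocale uq_action n ladder_act q
proof
  fix g :: uq_gen and v w :: "complex vec" and a :: complex
  assume v: "v \<in> carrier_vec n"
  show "ladder_act g v \<in> carrier_vec n"
    by (cases g) auto
  show "ladder_act g (v + w) = ladder_act g v + ladder_act g w" if "w \<in> carrier_vec n"
    using v that by (cases g) (auto intro!: eq_vecI simp: algebra_simps)
  show "ladder_act g (a \<cdot>\<^sub>v v) = a \<cdot>\<^sub>v ladder_act g v"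
    using v by (cases g) (auto intro!: eq_vecI)
  have cancel: "l * inverse q ^ i * (inverse l * q ^ i * x) = x"
    "inverse l * q ^ i * (l * inverse q ^ i * x) = x" for i x
  proof -
    have "l * A * (inverse l * B * x) = B * A * x" "inverse l * B * (l * A * x) = B * A * x" for A B
      using l_nonzero by simp_all
    then show "l * inverse q ^ i * (inverse l * q ^ i * x) = x"
      "inverse l * q ^ i * (l * inverse q ^ i * x) = x"
      by (simp_all only: q_power_inverse mult_1_left)
  qed
  show "ladder_act QH (ladder_act QHinv v) = v"
    by (rule eq_vecI) (use v in \<open>simp_all add: cancel\<close>)
  show "ladder_act QHinv (ladder_act QH v) = v"
    by (rule eq_vecI) (use v in \<open>simp_all add: cancel\<close>)
  show "ladder_act QH (ladder_act Jplus (ladder_act QHinv v)) = q \<cdot>\<^sub>v ladder_act Jplus v"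
    by (rule eq_vecI) (simp_all add: conjugate_QH q_power_up)
  show "ladder_act QH (ladder_act Jminus (ladder_act QHinv v)) = inverse q \<cdot>\<^sub>v ladder_act Jminus v"
    by (rule eq_vecI) (simp_all add: conjugate_QH q_power_down)
  show "ladder_act Jplus (ladder_act Jminus v) - ladder_act Jminus (ladder_act Jplus v)
    = inverse (q - inverse q) \<cdot>\<^sub>v
        (ladder_act QH (ladder_act QH v) - ladder_act QHinv (ladder_act QHinv v))"
    (is "?L = ?R")
  proof (rule eq_vecI)
    fix i assume "i < dim_vec ?R"
    then have i: "i < n" by simp
    \<comment> \<open>Going up and then down, or down and then up, returns to \<open>i\<close>, so
      the commutator is diagonal and \<open>coeff_step\<close> decides it.\<close>
    have "?L $ i = coeff (Suc i) * step (up i) * v $ i - step i * coeff (Suc (down i)) * v $ i"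
      using i by (simp add: up_down down_up)
    also have "\<dots> = (coeff (Suc i) - coeff i) * v $ i"
      using i by (simp add: coeff_step_up step_coeff_down left_diff_distrib)
    also have "\<dots> = inverse (q - inverse q) *
        (l * inverse q ^ i * (l * inverse q ^ i * v $ i) - inverse l * q ^ i * (inverse l * q ^ i * v $ i))"
      unfolding coeff_step[OF i] power2_eq_square by (simp only: left_diff_distrib mult.assoc)
    also have "\<dots> = ?R $ i"
      using i by simp
    finally show "?L $ i = ?R $ i" .
  qed simp
qed

section \<open>Irreducibility and highest weight vectors of ladder modules\<close>

text \<open>Only moves that avoid the wrap, so both closings are treated alike; with nonzero
  coefficients they connect all basis vectors.\<close>

lemma ladder_act_unit_vec:
  assumes k: "Suc k < n"
  shows "ladder_act Jminus (unit_vec n k) = unit_vec n (Suc k)"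
    and "ladder_act Jplus (unit_vec n (Suc k)) = coeff (Suc k) \<cdot>\<^sub>v unit_vec n k"
proof -
  show "ladder_act Jminus (unit_vec n k) = unit_vec n (Suc k)"
  proof (rule eq_vecI)
    fix i assume "i < dim_vec (unit_vec n (Suc k))"
    then show "ladder_act Jminus (unit_vec n k) $ i = unit_vec n (Suc k) $ i"
      using k by (cases i) (simp_all add: down_def step_def)
  qed simp
  show "ladder_act Jplus (unit_vec n (Suc k)) = coeff (Suc k) \<cdot>\<^sub>v unit_vec n k"
  proof (rule eq_vecI)
    fix i assume "i < dim_vec (coeff (Suc k) \<cdot>\<^sub>v unit_vec n k)"
    then show "ladder_act Jplus (unit_vec n (Suc k)) $ i = (coeff (Suc k) \<cdot>\<^sub>v unit_vec n k) $ i"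
      using k by (simp add: up_def)
  qed simp
qed

text \<open>A nonzero vector of the subspace with minimal support is a multiple of a unit vector, since
  subtracting an eigenvalue from the diagonal operator would otherwise shrink its support.\<close>

lemma invariant_subspace_full:
  assumes distinct: "\<And>k. 0 < k \<Longrightarrow> k < n \<Longrightarrow> q ^ k \<noteq> 1"
    and coeff: "\<And>k. 0 < k \<Longrightarrow> k < n \<Longrightarrow> coeff k \<noteq> 0"
    and W: "W \<subseteq> carrier_vec n"
    and add: "\<And>v w. v \<in> W \<Longrightarrow> w \<in> W \<Longrightarrow> v + w \<in> W"
    and smult: "\<And>a v. v \<in> W \<Longrightarrow> a \<cdot>\<^sub>v v \<in> W"
    and act: "\<And>g v. v \<in> W \<Longrightarrow> ladder_act g v \<in> W"
    and u: "u \<in> W" "u \<noteq> 0\<^sub>v n"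
  shows "W = carrier_vec n"
proof
  define supp where "supp v = {i. i < n \<and> v $ i \<noteq> 0}" for v :: "complex vec"
  obtain v where v: "v \<in> W" "v \<noteq> 0\<^sub>v n"
    and min: "\<And>w. w \<in> W \<Longrightarrow> w \<noteq> 0\<^sub>v n \<Longrightarrow> card (supp v) \<le> card (supp w)"
    using ex_has_least_nat[of "\<lambda>v. v \<in> W \<and> v \<noteq> 0\<^sub>v n" u "\<lambda>v. card (supp v)"] u by auto
  have dim: "dim_vec v = n"
    using v(1) W by auto
  obtain i where i: "i < n" "v $ i \<noteq> 0"
    using v(2) dim eq_vecI[of v "0\<^sub>v n"] by auto
  \<comment> \<open>K has pairwise distinct eigenvalues: a coincidence would give
    \<open>q ^ (k - j) = 1\<close> with 0 < k - j < n.\<close>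
  have power_inj: "inverse q ^ j \<noteq> inverse q ^ k" if "j < k" "k < n" for j k
  proof
    assume "inverse q ^ j = inverse q ^ k"
    then have "q ^ j = q ^ k"
      by (simp add: power_inverse)
    also have "\<dots> = q ^ j * q ^ (k - j)"
      using that by (simp flip: power_add)
    finally show False
      using distinct[of "k - j"] that q_nonzero by simp
  qed
  have "v $ j = 0" if j: "j < n" "j \<noteq> i" for j
  proof (rule ccontr)
    assume vj: "v $ j \<noteq> 0"
    define w where "w = ladder_act QH v + (- (l * inverse q ^ i)) \<cdot>\<^sub>v v"
    have w: "w $ k = l * (inverse q ^ k - inverse q ^ i) * v $ k" if "k < n" for k
      using that dim by (simp add: w_def algebra_simps)
    have "w \<in> W"
      unfolding w_def using v(1) by (intro add act smult)
    moreover have "inverse q ^ j - inverse q ^ i \<noteq> 0"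
      using j i(1) power_inj[of i j] power_inj[of j i] by (cases i j rule: linorder_cases) auto
    then have "w $ j \<noteq> 0"
      using w[OF j(1)] vj l_nonzero by simp
    then have "w \<noteq> 0\<^sub>v n"
      using j(1) by auto
    ultimately have "card (supp v) \<le> card (supp w)"
      by (rule min)
    moreover have "w $ i = 0" "\<And>k. k < n \<Longrightarrow> v $ k = 0 \<Longrightarrow> w $ k = 0"
      using i(1) by (simp_all add: w)
    then have "supp w \<subset> supp v"
      using i unfolding supp_def by blast
    then have "card (supp w) < card (supp v)"
      by (intro psubset_card_mono) (auto simp: supp_def)
    ultimately show False by simp
  qed
  then have "unit_vec n i = inverse (v $ i) \<cdot>\<^sub>v v"
    using i dim by (intro eq_vecI) auto
  then have ei: "unit_vec n i \<in> W"
    using smult v(1) by simp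
  \<comment> \<open>J^+ leads from v_i to v_0, dividing by a nonzero coefficient each time; once
    \<open>k\<close> exceeds \<open>i\<close>, truncated subtraction stays at 0.\<close>
  have down: "unit_vec n (i - k) \<in> W" for k
  proof (induction k)
    case (Suc k)
    show ?case
    proof (cases "k < i")
      case True
      define j where "j = i - Suc k"
      have j: "Suc j < n" "i - k = Suc j"
        using True i(1) by (auto simp: j_def)
      have "coeff (Suc j) \<cdot>\<^sub>v unit_vec n j \<in> W"
        using act[OF Suc.IH, of Jplus] unfolding j(2) ladder_act_unit_vec(2)[OF j(1)] .
      then have "inverse (coeff (Suc j)) \<cdot>\<^sub>v (coeff (Suc j) \<cdot>\<^sub>v unit_vec n j) \<in> W"
        by (rule smult)
      then show ?thesis
        using coeff[of "Suc j"] j(1) by (simp add: smult_smult_assoc flip: j_def)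
    qed (use Suc.IH in simp)
  qed (use ei in simp)
  \<comment> \<open>From v_0 the operator J^- reaches every basis vector, with coefficient
    1.\<close>
  have units: "unit_vec n k \<in> W" if "k < n" for k
    using that
  proof (induction k)
    case 0
    show ?case using down[of i] by simp
  next
    case (Suc k)
    then show ?case
      using act[of "unit_vec n k" Jminus] ladder_act_unit_vec(1)[of k] by simp
  qed
  show "carrier_vec n \<subseteq> W"
  proof
    fix x :: "complex vec"
    assume x: "x \<in> carrier_vec n"
    \<comment> \<open>\<open>x\<close> is assembled one coordinate at a time, since \<open>W\<close>
      is known to be closed under binary sums; the start is the zero vector, obtained as
      \<open>0 \<cdot>\<^sub>v v\<close>.\<close>
    have "vec n (\<lambda>j. if j < k then x $ j else 0) \<in> W" if "k \<le> n" for k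
      using that
    proof (induction k)
      case 0
      have "vec n (\<lambda>j. if j < 0 then x $ j else 0) = 0 \<cdot>\<^sub>v v"
        using dim by (intro eq_vecI) auto
      then show ?case
        using smult v(1) by simp
    next
      case (Suc k)
      have "vec n (\<lambda>j. if j < Suc k then x $ j else 0)
        = vec n (\<lambda>j. if j < k then x $ j else 0) + x $ k \<cdot>\<^sub>v unit_vec n k"
        using Suc.prems by (intro eq_vecI) (auto simp: less_Suc_eq unit_vec_def)
      then show ?case
        using Suc units[of k] add smult by simp
    qed
    from this[of n] have "vec n (\<lambda>j. if j < n then x $ j else 0) \<in> W" by simp
    moreover have "vec n (\<lambda>j. if j < n then x $ j else 0) = x"
      using x by (intro eq_vecI) auto
    ultimately show "x \<in> W" by simp
  qed
qed (rule W)

text \<open>A subrepresentation is stable under the classes of the generators, which act by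
  \<open>ladder_act\<close>, so \<open>invariant_subspace_full\<close> applies once it contains a
  nonzero vector.\<close>

lemma uq_irreducible_ladder:
  assumes "\<And>k. 0 < k \<Longrightarrow> k < n \<Longrightarrow> q ^ k \<noteq> 1"
    and "\<And>k. 0 < k \<Longrightarrow> k < n \<Longrightarrow> coeff k \<noteq> 0"
  shows "uq_irreducible q V uq_act"
  unfolding uq_irreducible_def
proof (intro conjI allI impI)
  show "uq_rep q V uq_act"
    by (rule uq_rep_uq_act)
  have "unit_vec n 0 \<in> carrier V" "unit_vec n 0 \<noteq> \<zero>\<^bsub>V\<^esub>"
    using n_pos by (simp_all add: module_vec_simps)
  then show "carrier V \<noteq> {\<zero>\<^bsub>V\<^esub>}"
    by blast
  fix W assume "uq_subrep q V uq_act W"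
  then have sub: "submodule class_ring W V"
    and inv: "\<And>a w. a \<in> carrier (Uq q) \<Longrightarrow> w \<in> W \<Longrightarrow> uq_act a w \<in> W"
    by (auto simp: uq_subrep_def VectorSpace.subspace_def)
  interpret submodule class_ring W V by (rule sub)
  have W: "W \<subseteq> carrier_vec n"
    using subset by (simp add: module_vec_simps)
  have gen: "ladder_act g w \<in> W" if "w \<in> W" for g w
    using inv[of "uq_gen_elt q g" w] that W uq_act_gen[of w g]
    by (auto simp: carrier_Uq uq_gen_elt_def)
  have "W = carrier_vec n" if "u \<in> W" "u \<noteq> 0\<^sub>v n" for u
    using invariant_subspace_full[OF assms W m_closed[unfolded module_vec_simps]
        smult_closed[unfolded module_vec_simps] gen that] by simp
  then show "W = {\<zero>\<^bsub>V\<^esub>} \<or> W = carrier V"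
    using zero_closed by (auto simp: module_vec_simps)
qed

text \<open>J^+ is a weighted cyclic shift, injective when all weights are nonzero. The range
  includes \<open>k = n\<close> because \<open>coeff n\<close> is the weight of the wrap.\<close>

lemma not_highest_weight_ladder:
  assumes "\<And>k. 0 < k \<Longrightarrow> k \<le> n \<Longrightarrow> coeff k \<noteq> 0"
  shows "\<not> uq_highest_weight q V uq_act"
proof
  assume "uq_highest_weight q V uq_act"
  then obtain v where v: "v \<in> carrier_vec n" "v \<noteq> 0\<^sub>v n"
    and "uq_act (uq_gen_elt q Jplus) v = 0\<^sub>v n"
    by (auto simp: uq_highest_weight_def module_vec_simps)
  then have eq: "ladder_act Jplus v = 0\<^sub>v n"
    by (simp add: uq_act_gen)
  have "v $ k = 0" if k: "k < n" for k
  proof -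
    have "ladder_act Jplus v $ down k = 0"
      unfolding eq using k by simp
    then have "coeff (Suc (down k)) * v $ k = 0"
      using k by (simp add: up_down)
    moreover have "Suc (down k) \<le> n"
      using k by (simp add: Suc_le_eq)
    ultimately show ?thesis
      using assms[of "Suc (down k)"] by simp
  qed
  then have "v = 0\<^sub>v n"
    using v(1) by (intro eq_vecI) auto
  with v(2) show False by contradiction
qed

end

section \<open>Choice of parameters and the three claims\<close>

text \<open>The truncated ladder has \<open>coeff k\<close> = [k][N-k], and the condition on
  \<open>q ^ (2 * k)\<close> keeps both factors nonzero as well as the eigenvalues of K
  distinct.\<close>

lemma irreducible_of_small_dim:
  fixes q :: complex
  assumes q: "q \<noteq> 0" "q - inverse q \<noteq> 0" and N: "0 < N"
    and distinct: "\<And>k. 0 < k \<Longrightarrow> k < N \<Longrightarrow> q ^ (2 * k) \<noteq> 1"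
  shows "\<exists>(V :: (complex, complex vec) module) \<rho>. uq_irreducible q V \<rho> \<and> has_dim V N"
proof -
  interpret ladder q "csqrt (q ^ (N - 1))" 0 0 N
    by unfold_locales (use q N in simp_all)
  have "q ^ k \<noteq> 1" if "0 < k" "k < N" for k
    using distinct[OF that] by (auto simp: power_mult mult.commute[of 2])
  moreover have "coeff k \<noteq> 0" if "0 < k" "k < N" for k
  proof -
    have "qint q k \<noteq> 0"
      using distinct that by (intro qint_nonzero q)
    moreover have "qint q (N - k) \<noteq> 0"
      using distinct that by (intro qint_nonzero q) auto
    ultimately show ?thesis
      by (simp add: coeff_def)
  qed
  ultimately have "uq_irreducible q V uq_act"
    by (rule uq_irreducible_ladder)
  with has_dim_V show ?thesis
    by blast
qed

lemma irreducible_not_highest_weight: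
  fixes q :: complex
  assumes q: "q \<noteq> 0" "q - inverse q \<noteq> 0" and m: "0 < m" "q ^ m = 1"
    and distinct: "\<And>k. 0 < k \<Longrightarrow> k < m \<Longrightarrow> q ^ k \<noteq> 1"
  shows "\<exists>(V :: (complex, complex vec) module) \<rho>.
    uq_irreducible q V \<rho> \<and> has_dim V m \<and> \<not> uq_highest_weight q V \<rho>"
proof -
  \<comment> \<open>avoid the finitely many values of d at which some coefficient vanishes\<close>
  have "finite ((\<lambda>k. - (qint q k * qint q (m - k))) ` {..m})"
    by simp
  then obtain d where d: "d \<notin> (\<lambda>k. - (qint q k * qint q (m - k))) ` {..m}"
    using ex_new_if_finite[OF infinite_UNIV_char_0] by blast
  interpret ladder q "csqrt (q ^ (m - 1))" 1 d m
    by unfold_locales (use q m in simp_all)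
  have coeff: "coeff k \<noteq> 0" if "k \<le> m" for k
    using d that by (auto simp: coeff_def eq_neg_iff_add_eq_0)
  have "uq_irreducible q V uq_act"
    using distinct coeff by (intro uq_irreducible_ladder) simp_all
  moreover have "\<not> uq_highest_weight q V uq_act"
    using coeff by (intro not_highest_weight_ladder)
  ultimately show ?thesis
    using has_dim_V by blast
qed

text \<open>Reducing the exponent modulo \<open>m\<close> leaves a remainder below \<open>m\<close>,
  which minimality forces to be 0.\<close>

lemma least_exponent_dvd:
  fixes q :: "'a::monoid_mult"
  assumes "0 < m" "q ^ m = 1" and least: "\<And>k. 0 < k \<Longrightarrow> k < m \<Longrightarrow> q ^ k \<noteq> 1"
    and "q ^ j = 1"
  shows "m dvd j"
proof -
  have "q ^ j = q ^ (m * (j div m) + j mod m)"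
    by simp
  also have "\<dots> = q ^ (j mod m)"
    unfolding power_add power_mult using assms(2) by simp
  finally have "j mod m = 0"
    using least[of "j mod m"] assms(1,4) by fastforce
  then show ?thesis
    by (simp add: dvd_eq_mod_eq_0)
qed

theorem mainTheorem1:
  fixes q :: complex and m :: nat
  assumes "q \<noteq> 0" and "q \<noteq> 1" and "q \<noteq> -1"
    and "\<exists>n>0. q ^ n = 1"
    and "m = (LEAST n. n > 0 \<and> q ^ n = 1)"
  shows "(odd m \<longrightarrow>
           (\<forall>N. 1 \<le> N \<and> N \<le> m \<longrightarrow>
             (\<exists>(V :: (complex, complex vec) module) \<rho>. uq_irreducible q V \<rho> \<and> has_dim V N)))
       \<and> (even m \<longrightarrow>
           (\<forall>N. (1 \<le> N \<and> N \<le> m div 2) \<or> N = m \<longrightarrow>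
             (\<exists>(V :: (complex, complex vec) module) \<rho>. uq_irreducible q V \<rho> \<and> has_dim V N)))
       \<and> \<not> (\<forall>(V :: (complex, complex vec) module) \<rho>.
             uq_irreducible q V \<rho> \<and> has_dim V m \<longrightarrow> uq_highest_weight q V \<rho>)"
proof -
  have m: "m > 0" "q ^ m = 1"
    using LeastI_ex[OF assms(4)] unfolding assms(5) by auto
  have least: "q ^ k \<noteq> 1" if "0 < k" "k < m" for k
    using not_less_Least[OF that(2)[unfolded assms(5)]] that(1) by simp
  have "q * q \<noteq> 1"
    using assms(2,3) by (auto simp: square_eq_1_iff)
  then have q: "q \<noteq> 0" "q - inverse q \<noteq> 0"
    using assms(1) by (auto simp: field_simps)
  \<comment> \<open>The cyclic module serves twice: as the counterexample in (iii), and as the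
    module of dimension \<open>m\<close> for even \<open>m\<close>, where the truncated ladder of
    that length has \<open>coeff (m div 2) = 0\<close>.\<close>
  obtain V' :: "(complex, complex vec) module" and \<rho>' where generic:
    "uq_irreducible q V' \<rho>'" "has_dim V' m" "\<not> uq_highest_weight q V' \<rho>'"
    using irreducible_not_highest_weight[OF q m least] by blast
  \<comment> \<open>For odd \<open>m\<close> the square of \<open>q\<close> has order
    \<open>m\<close> too, so [k] is nonzero for 0 < k < m.\<close>
  have "\<exists>(V :: (complex, complex vec) module) \<rho>. uq_irreducible q V \<rho> \<and> has_dim V N"
    if "odd m" "1 \<le> N" "N \<le> m" for N
  proof (rule irreducible_of_small_dim[OF q])
    fix k assume k: "0 < k" "k < N"
    show "q ^ (2 * k) \<noteq> 1"
    proof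
      assume "q ^ (2 * k) = 1"
      with m least have "m dvd 2 * k"
        by (rule least_exponent_dvd)
      then have "m dvd k"
        using \<open>odd m\<close> by (simp add: coprime_dvd_mult_right_iff)
      then show False
        using k \<open>N \<le> m\<close> by (auto dest: dvd_imp_le)
    qed
  qed (use that in simp)
  moreover have "\<exists>(V :: (complex, complex vec) module) \<rho>. uq_irreducible q V \<rho> \<and> has_dim V N"
    if "1 \<le> N \<and> N \<le> m div 2 \<or> N = m" for N
    using that
  proof
    \<comment> \<open>Here 2k < 2N \<le> m, so minimality of \<open>m\<close> applies to the
      exponent 2k directly.\<close>
    assume N: "1 \<le> N \<and> N \<le> m div 2"
    show ?thesis
    proof (rule irreducible_of_small_dim[OF q])
      fix k assume "0 < k" "k < N"
      then show "q ^ (2 * k) \<noteq> 1"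
        using N by (intro least) auto
    qed (use N in simp)
  qed (use generic in blast)
  ultimately show ?thesis
    using generic by blast
qed

end
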